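(* Let $T$ be an $L$-layer transformer ($L\ge 1$) with embedding dimension $d$, on sequences of length $n$ over a vocabulary of size $m$. Assume the input embeddings are bounded in norm by $R$, and let $K$ be the Lipschitz constant of the transformer with respect to the inputs. If $d<m$ and $T$ solves the Most Frequent Element task, then $$K\ \ge\ \Omega\Big(\frac{\sqrt n}{R}\cdot m^{1/d}\Big),$$ i.e. there are absolute constants $c>0$ and $n_0$ such that for all $n\ge n_0$ one has $K\ge c\,\frac{\sqrt n}{R}\,m^{1/d}$.
   Context: Each token $a\in\{1,\dots,m\}$ has an input embedding $\mathbf{v}_a\in\mathbb{R}^d$ with $\|\mathbf{v}_a\|\le R$ ($R>0$). The transformer is regarded as a function $T:\mathbb{R}^{d\times n}\to\mathbb{R}$ sending the matrix $X=(\mathbf{v}_{x_1},\dots,\mathbf{v}_{x_n})$ of token embeddings of a sequence $x_1,\dots,x_n$ to a scalar (positional embeddings being part of $T$). $K$ is its Lipschitz constant with respect to the Frobenius norm: $|T(X)-T(X')|\le K\|X-X'\|_F$ for all $X,X'$. The transformer is a composition of $L$ layers, each consisting of multi-head softmax self-attention with a residual connection, followed by a position-wise two-layer ReLU MLP with a residual connection, and a scalar readout. Most Frequent Element (MFE) task: given a sequence $x_1,\dots,x_n\in\{1,\dots,m\}$, let $c_z=\sum_{i=1}^n\mathbb{I}[x_i=z]$; the target output is $y_{MFE}=\max_z c_z$. "Solves" means that the scalar output equals $y_{MFE}$ for every sequence of length $n$. *)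

theory Defs
  imports Complex_Main "Jordan_Normal_Form.Matrix"
begin

(* A sequence of n token representations in R^d is a d x n matrix with one column per position.
   Explicit carriers (rather than type-indexed dimensions) allow quantification over d and n
   inside a formula. *)

definition eucl_norm :: "real vec \<Rightarrow> real" where
  "eucl_norm v = sqrt (v \<bullet> v)"

definition frobenius_norm :: "real mat \<Rightarrow> real" where
  "frobenius_norm A = sqrt (\<Sum>i<dim_row A. \<Sum>j<dim_col A. (A $$ (i, j))\<^sup>2)"

definition frobenius_lipschitz :: "nat \<Rightarrow> nat \<Rightarrow> real \<Rightarrow> (real mat \<Rightarrow> real) \<Rightarrow> bool" where
  "frobenius_lipschitz d n K T \<longleftrightarrow>
     (\<forall>X \<in> carrier_mat d n. \<forall>X' \<in> carrier_mat d n. \<bar>T X - T X'\<bar> \<le> K * frobenius_norm (X - X'))"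

(* "sees h j i": query position j may attend to key position i; constantly true for unmasked
   attention, "i <= j" for causal attention.  The customary factor 1 / sqrt (key dimension) in the
   scores is absorbed into the query weights. *)
record attention_head =
  query_weights :: "real mat"
  key_weights :: "real mat"
  value_weights :: "real mat"
  output_weights :: "real mat"
  sees :: "nat \<Rightarrow> nat \<Rightarrow> bool"

record transformer_layer =
  heads :: "attention_head list"
  mlp_weights1 :: "real mat"
  mlp_bias1 :: "real vec"
  mlp_weights2 :: "real mat"
  mlp_bias2 :: "real vec"

(* The scalar readout maps the pooled final representation (a linear combination of the columns) to
   a number.  A unit vector as pooling weights selects one position, e.g. the last one; constant
   weights 1/n give mean pooling. *)
record transformer =
  positions :: "real mat"
  transformer_layers :: "transformer_layer list"
  pooling_weights :: "real vec"
  readout :: "real vec \<Rightarrow> real"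

definition wf_head :: "nat \<Rightarrow> nat \<Rightarrow> attention_head \<Rightarrow> bool" where
  "wf_head d n h \<longleftrightarrow>
     (\<exists>k l. query_weights h \<in> carrier_mat k d \<and> key_weights h \<in> carrier_mat k d \<and>
            value_weights h \<in> carrier_mat l d \<and> output_weights h \<in> carrier_mat d l) \<and>
     (\<forall>j<n. sees h j j)"

definition wf_layer :: "nat \<Rightarrow> nat \<Rightarrow> transformer_layer \<Rightarrow> bool" where
  "wf_layer d n l \<longleftrightarrow>
     heads l \<noteq> [] \<and> (\<forall>h \<in> set (heads l). wf_head d n h) \<and>
     (\<exists>w. mlp_weights1 l \<in> carrier_mat w d \<and> mlp_bias1 l \<in> carrier_vec w \<and>
          mlp_weights2 l \<in> carrier_mat d w \<and> mlp_bias2 l \<in> carrier_vec d)"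

definition wf_transformer :: "nat \<Rightarrow> nat \<Rightarrow> nat \<Rightarrow> transformer \<Rightarrow> bool" where
  "wf_transformer L d n \<tau> \<longleftrightarrow>
     positions \<tau> \<in> carrier_mat d n \<and>
     length (transformer_layers \<tau>) = L \<and> (\<forall>l \<in> set (transformer_layers \<tau>). wf_layer d n l) \<and>
     pooling_weights \<tau> \<in> carrier_vec n"

(* Entry (i, j) of the result is the weight that query position j puts on position i, so each
   column is a probability vector. *)
definition attention_weights :: "attention_head \<Rightarrow> real mat \<Rightarrow> real mat" where
  "attention_weights h X =
     (let n = dim_col X;
          S = transpose_mat (key_weights h * X) * (query_weights h * X)
      in mat n n (\<lambda>(i, j). if sees h j i
           then exp (S $$ (i, j)) / (\<Sum>i' | i' < n \<and> sees h j i'. exp (S $$ (i', j)))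
           else 0))"

definition head_output :: "attention_head \<Rightarrow> real mat \<Rightarrow> real mat" where
  "head_output h X = output_weights h * (value_weights h * X * attention_weights h X)"

definition attention_block :: "attention_head list \<Rightarrow> real mat \<Rightarrow> real mat" where
  "attention_block hs X = foldr (\<lambda>h Y. head_output h X + Y) hs X"

definition add_bias :: "real mat \<Rightarrow> real vec \<Rightarrow> real mat" where
  "add_bias A b = mat (dim_row A) (dim_col A) (\<lambda>(i, j). A $$ (i, j) + b $ i)"

definition relu :: "real \<Rightarrow> real" where
  "relu t = max 0 t"

definition mlp_block :: "transformer_layer \<Rightarrow> real mat \<Rightarrow> real mat" where
  "mlp_block l Y =
     Y + add_bias (mlp_weights2 l * map_mat relu (add_bias (mlp_weights1 l * Y) (mlp_bias1 l)))
                  (mlp_bias2 l)"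

definition layer_fun :: "transformer_layer \<Rightarrow> real mat \<Rightarrow> real mat" where
  "layer_fun l X = mlp_block l (attention_block (heads l) X)"

definition transformer_fun :: "transformer \<Rightarrow> real mat \<Rightarrow> real" where
  "transformer_fun \<tau> X =
     readout \<tau> (fold layer_fun (transformer_layers \<tau>) (X + positions \<tau>) *\<^sub>v pooling_weights \<tau>)"

definition mfe :: "nat \<Rightarrow> nat list \<Rightarrow> nat" where
  "mfe m xs = Max ((\<lambda>z. count_list xs z) ` {1..m})"

definition embed :: "nat \<Rightarrow> (nat \<Rightarrow> real vec) \<Rightarrow> nat list \<Rightarrow> real mat" where
  "embed d v xs = mat_of_cols d (map v xs)"

definition solves_mfe ::
    "nat \<Rightarrow> nat \<Rightarrow> nat \<Rightarrow> (nat \<Rightarrow> real vec) \<Rightarrow> (real mat \<Rightarrow> real) \<Rightarrow> bool" where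
  "solves_mfe d n m v T \<longleftrightarrow>
     (\<forall>xs. length xs = n \<and> set xs \<subseteq> {1..m} \<longrightarrow> T (embed d v xs) = real (mfe m xs))"

end

theory Submission
  imports "HOL-Analysis.Ball_Volume" Defs
begin

text \<open>
  Comparing volumes, among the \<open>m\<close> embeddings in the ball of radius \<open>R\<close> there are two, of tokens
  \<open>a \<noteq> b\<close>, at distance at most \<open>4 R / m powr (1 / d)\<close>. Replacing half of the entries of the constant sequence
  \<open>a, \<dots>, a\<close> by \<open>b\<close> lowers the maximal count by about \<open>n / 2\<close> but moves the embedded sequence by only
  \<open>sqrt (n / 2)\<close> times that distance.
\<close>

text \<open>A finite product of sigma-finite measures is determined by its values on boxes.
  Translation acts on a box coordinate by coordinate, so invariance of one-dimensional Lebesgue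
  measure suffices.\<close>

lemma distr_PiM_lborel_translation:
  fixes p :: "'i \<Rightarrow> real"
  assumes I: "finite I"
  shows "distr (Pi\<^sub>M I (\<lambda>_. lborel)) (Pi\<^sub>M I (\<lambda>_. lborel)) (\<lambda>f. \<lambda>i\<in>I. f i + p i) = Pi\<^sub>M I (\<lambda>_. lborel)"
    (is "distr ?M ?M ?t = ?M")
proof -
  interpret product_sigma_finite "\<lambda>_::'i. lborel :: real measure"
    by (simp add: product_sigma_finite_def lborel.sigma_finite_measure_axioms)
  have t[measurable]: "?t \<in> measurable ?M ?M"
    by (rule measurable_restrict) simp
  show ?thesis
  proof (rule PiM_eqI[OF I])
    fix A :: "'i \<Rightarrow> real set"
    assume A: "\<And>i. i \<in> I \<Longrightarrow> A i \<in> sets lborel"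
    have pre: "?t -` Pi\<^sub>E I A \<inter> space ?M = Pi\<^sub>E I (\<lambda>i. (\<lambda>x. x + p i) -` A i)"
      by (auto simp: space_PiM PiE_iff)
    have meas: "(\<lambda>x. x + p i) -` A i \<in> sets lborel" if "i \<in> I" for i
    proof -
      have "(\<lambda>x. x + p i) -` A i \<inter> space borel \<in> sets borel"
        by (rule measurable_sets[of _ borel borel]) (use A[OF that] in auto)
      then show ?thesis by simp
    qed
    have inv: "emeasure lborel ((\<lambda>x. x + p i) -` A i) = emeasure lborel (A i)" if "i \<in> I" for i
    proof -
      have "emeasure lborel (A i) = emeasure (distr lborel borel ((+) (p i))) (A i)"
        by (simp add: lborel_distr_plus)
      also have "\<dots> = emeasure lborel ((+) (p i) -` A i \<inter> space lborel)"
        by (rule emeasure_distr) (use A[OF that] in auto)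
      also have "(+) (p i) -` A i \<inter> space lborel = (\<lambda>x. x + p i) -` A i"
        by (auto simp: add.commute)
      finally show ?thesis by simp
    qed
    have "emeasure (distr ?M ?M ?t) (Pi\<^sub>E I A) = emeasure ?M (?t -` Pi\<^sub>E I A \<inter> space ?M)"
      by (rule emeasure_distr) (use A I in \<open>auto intro!: sets_PiM_I_finite\<close>)
    also have "\<dots> = (\<Prod>i\<in>I. emeasure lborel ((\<lambda>x. x + p i) -` A i))"
      unfolding pre by (rule emeasure_PiM[OF I]) (use meas in auto)
    also have "\<dots> = (\<Prod>i\<in>I. emeasure lborel (A i))"
      by (rule prod.cong) (auto simp: inv)
    finally show "emeasure (distr ?M ?M ?t) (Pi\<^sub>E I A) = (\<Prod>i\<in>I. emeasure lborel (A i))" .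
  qed simp
qed

text \<open>The closed Euclidean ball in dimension \<open>card I\<close>, realised in a product
  space because the dimension \<open>d\<close> of the theorem is a term and not a type. The centre
  \<open>p\<close> matters only on \<open>I\<close> and need not lie in the space.\<close>

definition L2_cball :: "'i set \<Rightarrow> ('i \<Rightarrow> real) \<Rightarrow> real \<Rightarrow> ('i \<Rightarrow> real) set" where
  "L2_cball I p r = {f \<in> space (Pi\<^sub>M I (\<lambda>_. lborel)). L2_set (\<lambda>i. f i - p i) I \<le> r}"

lemma sets_L2_cball: "finite I \<Longrightarrow> L2_cball I p r \<in> sets (Pi\<^sub>M I (\<lambda>_. lborel))"
  unfolding L2_cball_def L2_set_def by measurable

text \<open>Translation invariance moves the centre to the origin, where the volume is given by
  \<open>emeasure_cball_aux\<close>.\<close>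

lemma emeasure_L2_cball:
  assumes "finite I" "r > 0"
  shows "emeasure (Pi\<^sub>M I (\<lambda>_. lborel)) (L2_cball I p r)
    = ennreal (unit_ball_vol (real (card I)) * r ^ card I)"
proof -
  let ?M = "Pi\<^sub>M I (\<lambda>_. lborel :: real measure)"
  let ?t = "\<lambda>f. \<lambda>i\<in>I. f i + p i"
  have t: "?t \<in> measurable ?M ?M"
    by (rule measurable_restrict) simp
  have "emeasure ?M (L2_cball I p r) = emeasure (distr ?M ?M ?t) (L2_cball I p r)"
    by (simp add: distr_PiM_lborel_translation assms)
  also have "\<dots> = emeasure ?M (?t -` L2_cball I p r \<inter> space ?M)"
    by (rule emeasure_distr[OF t]) (simp add: sets_L2_cball assms)
  also have "?t -` L2_cball I p r \<inter> space ?M = {f. sqrt (\<Sum>i\<in>I. (f i)\<^sup>2) \<le> r} \<inter> space ?M"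
    by (auto simp: L2_cball_def L2_set_def space_PiM)
  also have "emeasure ?M \<dots> = ennreal (unit_ball_vol (real (card I)) * r ^ card I)"
    by (rule emeasure_cball_aux) (use assms in auto)
  finally show ?thesis .
qed

text \<open>Packing bound: the balls of radius \<open>\<delta> / 2\<close> about the points are
  disjoint and lie in the ball of radius \<open>R + \<delta> / 2\<close> about the origin. Comparing
  volumes, the unit ball volume cancels.\<close>

lemma card_separated_in_ball_le:
  fixes p :: "'a \<Rightarrow> 'i \<Rightarrow> real"
  assumes I: "finite I" and A: "finite A" and "R > 0" "\<delta> > 0"
    and bound: "\<And>a. a \<in> A \<Longrightarrow> L2_set (p a) I \<le> R"
    and sep: "\<And>a b. a \<in> A \<Longrightarrow> b \<in> A \<Longrightarrow> a \<noteq> b \<Longrightarrow> \<delta> < L2_set (\<lambda>i. p a i - p b i) I"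
  shows "real (card A) * (\<delta> / 2) ^ card I \<le> (R + \<delta> / 2) ^ card I"
proof -
  let ?M = "Pi\<^sub>M I (\<lambda>_. lborel :: real measure)"
  let ?u = "unit_ball_vol (real (card I))"
  have u: "?u > 0" by simp
  \<comment> \<open>The balls are closed, so balls at distance exactly \<open>\<delta>\<close> would
    touch; this is why the separation is strict.\<close>
  have disj: "disjoint_family_on (\<lambda>a. L2_cball I (p a) (\<delta> / 2)) A"
  proof (clarsimp simp: disjoint_family_on_def, rule ccontr)
    fix a b assume ab: "a \<in> A" "b \<in> A" "a \<noteq> b"
      and "L2_cball I (p a) (\<delta> / 2) \<inter> L2_cball I (p b) (\<delta> / 2) \<noteq> {}"
    then obtain f where f: "L2_set (\<lambda>i. f i - p a i) I \<le> \<delta> / 2" "L2_set (\<lambda>i. f i - p b i) I \<le> \<delta> / 2"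
      by (auto simp: L2_cball_def)
    have "L2_set (\<lambda>i. p a i - p b i) I
        \<le> L2_set (\<lambda>i. p a i - f i) I + L2_set (\<lambda>i. f i - p b i) I"
      using L2_set_triangle_ineq[of "\<lambda>i. p a i - f i" "\<lambda>i. f i - p b i" I] by simp
    also have "L2_set (\<lambda>i. p a i - f i) I = L2_set (\<lambda>i. f i - p a i) I"
      by (simp add: L2_set_def power2_commute)
    finally show False using f sep[OF ab] by linarith
  qed
  have sub: "(\<Union>a\<in>A. L2_cball I (p a) (\<delta> / 2)) \<subseteq> L2_cball I (\<lambda>_. 0) (R + \<delta> / 2)"
  proof clarify
    fix f a assume a: "a \<in> A" and f: "f \<in> L2_cball I (p a) (\<delta> / 2)"
    have "L2_set f I \<le> L2_set (\<lambda>i. f i - p a i) I + L2_set (p a) I"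
      using L2_set_triangle_ineq[of "\<lambda>i. f i - p a i" "p a" I] by simp
    with f bound[OF a] show "f \<in> L2_cball I (\<lambda>_. 0) (R + \<delta> / 2)"
      by (auto simp: L2_cball_def)
  qed
  have "ennreal (real (card A) * (?u * (\<delta> / 2) ^ card I))
      = (\<Sum>a\<in>A. emeasure ?M (L2_cball I (p a) (\<delta> / 2)))"
    using \<open>\<delta> > 0\<close> u
    by (simp add: emeasure_L2_cball I ennreal_mult ennreal_of_nat_eq_real_of_nat)
  also have "\<dots> = emeasure ?M (\<Union>a\<in>A. L2_cball I (p a) (\<delta> / 2))"
    by (rule sum_emeasure) (use A I disj sets_L2_cball in auto)
  also have "\<dots> \<le> emeasure ?M (L2_cball I (\<lambda>_. 0) (R + \<delta> / 2))"
    by (rule emeasure_mono[OF sub]) (simp add: sets_L2_cball I)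
  also have "\<dots> = ennreal (?u * (R + \<delta> / 2) ^ card I)"
    using \<open>\<delta> > 0\<close> \<open>R > 0\<close> by (simp add: emeasure_L2_cball I)
  finally have "real (card A) * (?u * (\<delta> / 2) ^ card I) \<le> ?u * (R + \<delta> / 2) ^ card I"
    using \<open>\<delta> > 0\<close> \<open>R > 0\<close> u by (subst (asm) ennreal_le_iff) auto
  then have "?u * (real (card A) * (\<delta> / 2) ^ card I) \<le> ?u * (R + \<delta> / 2) ^ card I"
    by (simp only: mult_ac)
  then show ?thesis using u by (simp only: mult_le_cancel_left_pos)
qed

text \<open>If all distances exceeded the bound, packing would force
  \<open>card A powr (1 / card I)\<close> to be at most 2. Then the bound is no smaller than the
  diameter of the ball, which no distance can exceed.\<close>

lemma ex_close_pair_in_ball: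
  fixes p :: "'a \<Rightarrow> 'i \<Rightarrow> real"
  assumes I: "finite I" "I \<noteq> {}" and A: "card A \<ge> 2" and R: "R > 0"
    and bound: "\<And>a. a \<in> A \<Longrightarrow> L2_set (p a) I \<le> R"
  shows "\<exists>a\<in>A. \<exists>b\<in>A. a \<noteq> b \<and>
    L2_set (\<lambda>i. p a i - p b i) I \<le> 4 * R / real (card A) powr (1 / real (card I))"
proof (rule ccontr)
  define s where "s = real (card A) powr (1 / real (card I))"
  assume "\<not> ?thesis"
  then have sep: "4 * R / s < L2_set (\<lambda>i. p a i - p b i) I" if "a \<in> A" "b \<in> A" "a \<noteq> b" for a b
    using that unfolding s_def by force
  have fin: "finite A" using A by (metis card.infinite not_numeral_le_zero)
  have s: "s > 0" using A unfolding s_def by simp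
  have cI: "card I > 0" using I by (simp add: card_gt_0_iff)
  \<comment> \<open>This absorbs the number of points into the power, so that roots can be taken on
    both sides of the packing bound.\<close>
  have s_pow: "s ^ card I = real (card A)"
    using cI A s by (simp add: s_def powr_powr flip: powr_realpow)
  have "real (card A) * (4 * R / s / 2) ^ card I \<le> (R + 4 * R / s / 2) ^ card I"
    by (rule card_separated_in_ball_le[where p = p and A = A])
      (use I R s fin bound sep in auto)
  then have "(s * (4 * R / s / 2)) ^ card I \<le> (R + 4 * R / s / 2) ^ card I"
    by (simp only: power_mult_distrib s_pow)
  then have "s * (4 * R / s / 2) \<le> R + 4 * R / s / 2"
    by (rule power_le_imp_le_base[of _ "card I - 1" for x, simplified Suc_diff_1[OF cI]])
      (use R s in auto)
  \<comment> \<open>The left side above is \<open>2 * R\<close> and the right side is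
    \<open>R + 2 * R / s\<close>.\<close>
  then have "R * s \<le> 2 * R" using s by (simp add: field_simps)
  then have s2: "s \<le> 2" using R by simp
  \<comment> \<open>Any two distinct points now give a contradiction: their distance is at most
    \<open>2 * R\<close>, hence at most \<open>4 * R / s\<close>.\<close>
  obtain a b where ab: "a \<in> A" "b \<in> A" "a \<noteq> b"
    using A by (metis card_2_iff' obtain_subset_with_card_n subset_iff)
  have "L2_set (\<lambda>i. p a i - p b i) I \<le> L2_set (p a) I + L2_set (\<lambda>i. - p b i) I"
    using L2_set_triangle_ineq[of "p a" "\<lambda>i. - p b i" I] by simp
  also have "L2_set (\<lambda>i. - p b i) I = L2_set (p b) I"
    by (simp add: L2_set_def)
  also have "L2_set (p a) I + L2_set (p b) I \<le> 2 * R"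
    using bound ab by (metis add_mono mult_2)
  also have "2 * R \<le> 4 * R / s"
    using s s2 R by (simp add: field_simps)
  finally show False using sep[OF ab] by simp
qed

lemma eucl_norm_eq_L2_set:
  "u \<in> carrier_vec d \<Longrightarrow> eucl_norm u = L2_set (vec_index u) {..<d}"
  by (auto simp: eucl_norm_def L2_set_def scalar_prod_def power2_eq_square lessThan_atLeast0)

text \<open>The two matrices differ only in the first \<open>k\<close> columns, and each of these
  contributes the same squared distance.\<close>

lemma frobenius_norm_embed_diff:
  assumes "k \<le> n"
  shows "frobenius_norm (embed d v (replicate n a) - embed d v (replicate k b @ replicate (n - k) a))
    = sqrt (real k) * L2_set (\<lambda>i. vec_index (v a) i - vec_index (v b) i) {..<d}"
proof -
  let ?q = "\<lambda>i. (vec_index (v a) i - vec_index (v b) i)\<^sup>2"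
  have "frobenius_norm (embed d v (replicate n a) - embed d v (replicate k b @ replicate (n - k) a))
    = sqrt (\<Sum>i<d. \<Sum>j<n. if j < k then ?q i else 0)"
    using assms unfolding frobenius_norm_def embed_def
    by (auto intro!: sum.cong simp: mat_of_cols_def nth_append)
  also have "\<dots> = sqrt (\<Sum>i<d. real k * ?q i)"
  proof -
    have "{..<n} \<inter> {j. j < k} = {..<k}" using assms by auto
    then show ?thesis by (simp add: sum.If_cases)
  qed
  also have "\<dots> = sqrt (real k) * L2_set (\<lambda>i. vec_index (v a) i - vec_index (v b) i) {..<d}"
    by (simp add: L2_set_def real_sqrt_mult flip: sum_distrib_left)
  finally show ?thesis .
qed

lemma mfe_replicate_append:
  assumes "a \<in> {1..m}" "a \<noteq> b" "k \<le> l"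
  shows "mfe m (replicate k b @ replicate l a) = l"
proof -
  have cnt: "count_list (replicate j x) z = (if x = z then j else 0)" for j x and z :: nat
    by (induction j) auto
  show ?thesis unfolding mfe_def
    by (rule Max_eqI) (use assms in \<open>auto simp: cnt intro!: image_eqI[of _ _ a]\<close>)
qed

theorem theorem5p2:
  shows "\<exists>c::real. c > 0 \<and> (\<exists>n0::nat. \<forall>n\<ge>n0.
    \<forall>(L::nat) (d::nat) (m::nat) (v :: nat \<Rightarrow> real vec) (R::real) (\<tau>::transformer) (K::real).
      L \<ge> 1 \<longrightarrow> d \<ge> 1 \<longrightarrow> d < m \<longrightarrow> R > 0 \<longrightarrow>
      (\<forall>a\<in>{1..m}. v a \<in> carrier_vec d \<and> eucl_norm (v a) \<le> R) \<longrightarrow>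
      wf_transformer L d n \<tau> \<longrightarrow>
      frobenius_lipschitz d n K (transformer_fun \<tau>) \<longrightarrow>
      solves_mfe d n m v (transformer_fun \<tau>) \<longrightarrow>
      K \<ge> c * (sqrt (real n) / R * real m powr (1 / real d)))"
\<comment> \<open>The 8 is the product of the 4 in the distance of the close pair and a 2 lost in
  passing from \<open>n\<close> to \<open>n div 2\<close>. The threshold 2 makes
  \<open>n div 2\<close> positive.\<close>
proof (rule exI[of _ "1 / 8"], intro conjI exI[of _ 2] allI impI)
  fix n L d m :: nat and v :: "nat \<Rightarrow> real vec" and R K :: real and \<tau> :: transformer
  assume n: "n \<ge> 2" and d: "d \<ge> 1" and m: "d < m" and R: "R > 0"
    and emb: "\<forall>a\<in>{1..m}. v a \<in> carrier_vec d \<and> eucl_norm (v a) \<le> R"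
    and lip: "frobenius_lipschitz d n K (transformer_fun \<tau>)"
    and sol: "solves_mfe d n m v (transformer_fun \<tau>)"
  \<comment> \<open>The largest number of entries that can become \<open>b\<close> while
    \<open>a\<close> stays a most frequent token; the target then drops by exactly
    \<open>k\<close>.\<close>
  define k where "k = n div 2"
  define s where "s = real m powr (1 / real d)"
  have k: "k \<le> n" "k \<le> n - k" "k \<ge> 1" "n \<le> 3 * k" using n unfolding k_def by auto
  have s: "s > 0" using m unfolding s_def by simp
  have bound: "L2_set (vec_index (v a)) {..<d} \<le> R" if "a \<in> {1..m}" for a
    using emb that eucl_norm_eq_L2_set by metis
  have "\<exists>a\<in>{1..m}. \<exists>b\<in>{1..m}. a \<noteq> b \<and>
    L2_set (\<lambda>i. vec_index (v a) i - vec_index (v b) i) {..<d}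
      \<le> 4 * R / real (card {1..m}) powr (1 / real (card {..<d}))"
    by (rule ex_close_pair_in_ball)
      (use d m R bound in \<open>auto simp: lessThan_empty_iff\<close>)
  then obtain a b where ab: "a \<in> {1..m}" "b \<in> {1..m}" "a \<noteq> b"
    and close: "L2_set (\<lambda>i. vec_index (v a) i - vec_index (v b) i) {..<d} \<le> 4 * R / s"
    unfolding s_def by auto
  let ?\<delta> = "L2_set (\<lambda>i. vec_index (v a) i - vec_index (v b) i) {..<d}"
  let ?xs = "replicate n a" and ?ys = "replicate k b @ replicate (n - k) a"
  \<comment> \<open>The case \<open>j = 0\<close> is the constant sequence and \<open>j = k\<close>
    the modified one.\<close>
  have T: "transformer_fun \<tau> (embed d v (replicate j b @ replicate (n - j) a)) = real (n - j)"
    if "j \<le> n" "j \<le> n - j" for j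
  proof -
    have "set (replicate j b @ replicate (n - j) a) \<subseteq> {1..m}"
      using ab by (auto simp: set_replicate_conv_if)
    moreover have "length (replicate j b @ replicate (n - j) a) = n"
      using that by simp
    ultimately show ?thesis
      using sol mfe_replicate_append[OF ab(1,3) that(2)] unfolding solves_mfe_def by metis
  qed
  have Tx: "transformer_fun \<tau> (embed d v ?xs) = real n" using T[of 0] by simp
  have Ty: "transformer_fun \<tau> (embed d v ?ys) = real (n - k)" using T k by blast
  have car: "embed d v xs \<in> carrier_mat d n" if "length xs = n" for xs
    using that unfolding embed_def by (auto simp: mat_of_cols_def)
  have "\<bar>real n - real (n - k)\<bar> \<le> K * (sqrt (real k) * ?\<delta>)"
    using lip car[of ?xs] car[of ?ys] k(1) frobenius_norm_embed_diff[OF k(1)] Tx Ty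
    unfolding frobenius_lipschitz_def by (metis length_append length_replicate le_add_diff_inverse)
  \<comment> \<open>The output changes by \<open>k\<close>, the input only by \<open>sqrt k\<close>
    times the distance; cancelling one root leaves the growth of order
    \<open>sqrt n\<close>.\<close>
  then have "sqrt (real k) * sqrt (real k) \<le> sqrt (real k) * (K * ?\<delta>)"
    using k by (simp add: mult_ac of_nat_diff)
  then have K\<delta>: "sqrt (real k) \<le> K * ?\<delta>"
    using k by (subst (asm) mult_le_cancel_left_pos) auto
  \<comment> \<open>The Lipschitz condition does not fix the sign of \<open>K\<close>. Positivity
    allows the distance in \<open>K * ?\<delta>\<close> to be replaced by its upper bound.\<close>
  have "K > 0"
  proof (rule ccontr)
    assume "\<not> K > 0"
    then have "K * ?\<delta> \<le> 0" by (simp add: mult_nonpos_nonneg)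
    moreover have "sqrt (real k) > 0" using k by simp
    ultimately show False using K\<delta> by linarith
  qed
  \<comment> \<open>The bound \<open>n \<le> 3 * k\<close>, sharp at \<open>n = 3\<close>, is
    relaxed to \<open>4 * k\<close> to have an integer root.\<close>
  have "sqrt (real n) \<le> sqrt (4 * real k)" using k by (intro real_sqrt_le_mono) linarith
  also have "\<dots> = 2 * sqrt (real k)" by (simp add: real_sqrt_mult)
  also have "\<dots> \<le> 2 * (K * (4 * R / s))"
    using K\<delta> close \<open>K > 0\<close> by (smt (verit) mult_left_mono)
  finally have "sqrt (real n) \<le> 8 * K * R / s" by (simp add: mult_ac)
  then show "1 / 8 * (sqrt (real n) / R * real m powr (1 / real d)) \<le> K"
    using R s unfolding s_def[symmetric] by (simp add: field_simps)
qed simp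

end
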